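(* Let $D>0$ be a nonsquare integer (a nonsquare discriminant) and let $m\ge1$ be an integer. For $x\in\mathbb R$ let $$A_{m+1,D}(x)=\sum_{\substack{R\in\mathbb Z[X],\ \deg R=2\\ \operatorname{disc}(R)=D,\ R(\infty)<0<R(x)}}R(x)^m .$$ Then $A_{m+1,D}$ is well defined (the series converges for every $x\in\mathbb R$), bounded, even, $1$-periodic and continuous on $\mathbb R$, and it satisfies $$x^{2m}A_{m+1,D}\!\left(\frac1x\right)-A_{m+1,D}(x)=-\sum_{\substack{R\in\mathbb Z[X],\ \deg R=2\\ \operatorname{disc}(R)=D,\ R(\infty)<0<R(0)}}R(x)\,|R(x)|^{m-1},\qquad x\ne0,$$ where the sum on the right-hand side is finite.
   Context: For a quadratic polynomial $R(X)=aX^2+bX+c$ with integer coefficients, $\operatorname{disc}(R)=b^2-4ac$, and the condition $R(\infty)<0$ means that the leading coefficient $a$ is negative. *)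

theory Defs
  imports "HOL-Analysis.Analysis" "HOL-Computational_Algebra.Computational_Algebra"
begin

text \<open>The polynomials under consideration have integer coefficients but are evaluated at real points.\<close>

definition eval_real :: "int poly \<Rightarrow> real \<Rightarrow> real" where
  "eval_real R x = poly (map_poly real_of_int R) x"

text \<open>This is the discriminant for polynomials of degree 2 only.\<close>

definition quad_disc :: "int poly \<Rightarrow> int" where
  "quad_disc R = (coeff R 1)\<^sup>2 - 4 * coeff R 2 * coeff R 0"

text \<open>The condition \<open>R(\<infinity>) < 0 < R(x)\<close> means that the leading coefficient is negative
  and that the value at \<open>x\<close> is positive.\<close>

definition neg_quads :: "int \<Rightarrow> real \<Rightarrow> int poly set" where
  "neg_quads D x =
     {R. degree R = 2 \<and> quad_disc R = D \<and> lead_coeff R < 0 \<and> 0 < eval_real R x}"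

text \<open>The index \<open>k\<close> is meant to be positive. An \<open>infsum\<close> that does not converge has the value \<open>0\<close>,
  so convergence has to be asserted separately.\<close>

definition A_sum :: "nat \<Rightarrow> int \<Rightarrow> real \<Rightarrow> real" where
  "A_sum k D x = (\<Sum>\<^sub>\<infinity>R\<in>neg_quads D x. eval_real R x ^ (k - 1))"

end

theory Submission
  imports Defs
begin

text \<open>
  Write \<open>R = (a, b, c)\<close> for \<open>a X\<^sup>2 + b X + c\<close>.  Translations \<open>X \<mapsto> X + 1\<close> and the reflection
  \<open>X \<mapsto> -X\<close> permute the summands, which gives periodicity and evenness.  The inversion
  \<open>(a, b, c) \<mapsto> (c, b, a)\<close> turns the condition \<open>a < 0\<close> into \<open>c < 0\<close>.  As \<open>D\<close> is not a square, \<open>a\<close> and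
  \<open>c\<close> never vanish, so the two conditions differ only for forms with \<open>a c < 0\<close>; since
  \<open>b\<^sup>2 + 4 \<bar>a c\<bar> = D\<close>, there are finitely many of these, and they produce the right-hand side of the
  functional equation (\<open>inversion_has_sum\<close>).

  The problem is convergence for \<open>m = 1\<close>: the bound \<open>R(x) \<le> D / (4 \<bar>a\<bar>)\<close> alone leads to a harmonic
  series.  Instead, \<open>m = 1\<close> is solved exactly.  Let \<open>\<gamma>\<close> be the sum of \<open>c\<close> over the forms with
  \<open>a < 0 < c\<close>.  The symmetries of that finite set show that the functional equation for \<open>m = 1\<close> is
  the one satisfied by the constant \<open>\<gamma>\<close>, and the series at \<open>0\<close> is \<open>\<gamma>\<close>; so by the
  Euclidean algorithm it converges to \<open>\<gamma>\<close> at every rational point.  By density and continuity every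
  finite partial sum is at most \<open>\<gamma>\<close> at every real point, which is convergence everywhere.
  The defect \<open>g = \<gamma> - A\<close> then takes values in \<open>[0, \<gamma>]\<close>, is \<open>1\<close>-periodic and satisfies
  \<open>g(x) = x\<^sup>2 g(1/x)\<close>.  Moving \<open>x\<close> into \<open>[-1/2, 1/2]\<close> first, this improves any bound \<open>K\<close> on \<open>g\<close> to
  \<open>K / 4\<close>, hence \<open>g = 0\<close> and the sum for \<open>m = 1\<close> is the constant \<open>\<gamma>\<close>.

  For general \<open>m\<close>, \<open>R(x)\<^sup>m \<le> D\<^bsup>m-1\<^esup> R(x)\<close> gives convergence and boundedness.  Continuity is a
  semicontinuity argument: a sum of nonnegative continuous functions is lower semicontinuous; this
  applies to \<open>A\<close> and to \<open>D\<^bsup>m-1\<^esup> \<gamma> - A\<close>, the latter being the sum of the functions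
  \<open>D\<^bsup>m-1\<^esup> R - R\<^sup>m\<close>, so \<open>A\<close> is upper semicontinuous too.
\<close>

section \<open>Forms as coefficient triples\<close>

definition forms :: "int \<Rightarrow> (int \<times> int \<times> int) set" where
  "forms D = {(a, b, c). b\<^sup>2 - 4 * a * c = D}"

definition qval :: "int \<times> int \<times> int \<Rightarrow> real \<Rightarrow> real" where
  "qval t x = (case t of (a, b, c) \<Rightarrow> of_int a * x\<^sup>2 + of_int b * x + of_int c)"

text \<open>Cutting off at \<open>0\<close> makes the index set of the sum independent of \<open>x\<close>, and the summands
  continuous in \<open>x\<close>.\<close>

definition pos_term :: "nat \<Rightarrow> real \<Rightarrow> int \<times> int \<times> int \<Rightarrow> real" where
  "pos_term m x t = (if fst t < 0 then (max 0 (qval t x)) ^ m else 0)"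

definition straddling :: "int \<Rightarrow> (int \<times> int \<times> int) set" where
  "straddling D = {(a, b, c). b\<^sup>2 - 4 * a * c = D \<and> a < 0 \<and> 0 < c}"

definition to_poly :: "int \<times> int \<times> int \<Rightarrow> int poly" where
  "to_poly t = (case t of (a, b, c) \<Rightarrow> [:c, b, a:])"

text \<open>The constant value of the sum for \<open>m = 1\<close>, called \<open>\<gamma>\<close> above.\<close>

definition gam :: "int \<Rightarrow> real" where
  "gam D = (\<Sum>(a, b, c)\<in>straddling D. of_int c)"

lemma pos_term_nonneg: "pos_term m x t \<ge> 0"
  by (simp add: pos_term_def)

lemma inj_to_poly: "inj to_poly"
  by (auto simp: inj_def to_poly_def)

lemma eval_to_poly: "eval_real (to_poly t) x = qval t x"
  by (cases t) (simp add: eval_real_def to_poly_def qval_def map_poly_pCons algebra_simps power2_eq_square)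

lemma neg_quads_eq:
  "neg_quads D x = to_poly ` {t \<in> forms D. fst t < 0 \<and> 0 < qval t x}"
proof (intro equalityI subsetI)
  fix R assume R: "R \<in> neg_quads D x"
  have deg: "degree R = 2" using R by (simp add: neg_quads_def)
  have eq: "R = to_poly (coeff R 2, coeff R 1, coeff R 0)"
  proof (rule poly_eqI)
    fix n show "coeff R n = coeff (to_poly (coeff R 2, coeff R 1, coeff R 0)) n"
      using coeff_eq_0[of R n] deg
      by (auto simp: to_poly_def coeff_pCons numeral_2_eq_2 split: nat.split)
  qed
  let ?t = "(coeff R 2, coeff R 1, coeff R 0)"
  have "qval ?t x = eval_real R x"
    using eval_to_poly[of ?t x] eq by simp
  then have "?t \<in> {t \<in> forms D. fst t < 0 \<and> 0 < qval t x}"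
    using R deg by (auto simp: neg_quads_def forms_def quad_disc_def)
  then show "R \<in> to_poly ` {t \<in> forms D. fst t < 0 \<and> 0 < qval t x}"
    using eq by blast
next
  fix R assume "R \<in> to_poly ` {t \<in> forms D. fst t < 0 \<and> 0 < qval t x}"
  then obtain t where t: "R = to_poly t" "t \<in> forms D" "fst t < 0" "0 < qval t x"
    by auto
  obtain a b c where abc: "t = (a, b, c)" by (cases t)
  show "R \<in> neg_quads D x"
    using t eval_to_poly[of t x]
    by (auto simp: neg_quads_def forms_def abc to_poly_def quad_disc_def numeral_2_eq_2)
qed

lemma has_sum_neg_quads_iff:
  assumes "m \<ge> 1"
  shows "((\<lambda>R. eval_real R x ^ m) has_sum s) (neg_quads D x) \<longleftrightarrow>
         (pos_term m x has_sum s) (forms D)"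
proof -
  have "((\<lambda>R. eval_real R x ^ m) has_sum s) (neg_quads D x) \<longleftrightarrow>
        ((\<lambda>t. qval t x ^ m) has_sum s) {t \<in> forms D. fst t < 0 \<and> 0 < qval t x}"
    unfolding neg_quads_eq
    by (subst has_sum_reindex)
       (auto intro: inj_on_subset[OF inj_to_poly] simp: o_def eval_to_poly)
  also have "\<dots> \<longleftrightarrow> (pos_term m x has_sum s) (forms D)"
    by (rule has_sum_cong_neutral) (use assms in \<open>auto simp: pos_term_def\<close>)
  finally show ?thesis .
qed

lemma finite_straddling: "finite (straddling D)"
proof (rule finite_subset)
  show "straddling D \<subseteq> {-\<bar>D\<bar>..\<bar>D\<bar>} \<times> {-\<bar>D\<bar>..\<bar>D\<bar>} \<times> {-\<bar>D\<bar>..\<bar>D\<bar>}"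
  proof
    fix t assume "t \<in> straddling D"
    then obtain a b c where t: "t = (a, b, c)" and D: "b\<^sup>2 - 4 * a * c = D" "a < 0" "0 < c"
      by (auto simp: straddling_def)
    define k where "k = - a * c"
    have "(- a) * 1 \<le> (- a) * c" "1 * c \<le> (- a) * c"
      by (intro mult_left_mono mult_right_mono; use D in simp)+
    then have "- a \<le> k" "c \<le> k" "D = b\<^sup>2 + 4 * k"
      using D by (simp_all add: k_def)
    moreover have "0 \<le> b\<^sup>2" by simp
    moreover have "\<bar>b\<bar> \<le> b\<^sup>2"
    proof (cases "b = 0")
      case False
      then have "\<bar>b\<bar> * 1 \<le> \<bar>b\<bar> * \<bar>b\<bar>" by (intro mult_left_mono) auto
      then show ?thesis by (simp add: power2_eq_square)
    qed simp
    ultimately show "t \<in> {-\<bar>D\<bar>..\<bar>D\<bar>} \<times> {-\<bar>D\<bar>..\<bar>D\<bar>} \<times> {-\<bar>D\<bar>..\<bar>D\<bar>}"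
      using D(2,3) by (auto simp: t)
  qed
qed auto

lemma straddling_eq: "{t \<in> forms D. fst t < 0 \<and> 0 < qval t 0} = straddling D"
  by (auto simp: forms_def straddling_def qval_def)

section \<open>Translation, reflection and inversion\<close>

lemma has_sum_shift:
  "(pos_term m (x + 1) has_sum s) (forms D) \<longleftrightarrow> (pos_term m x has_sum s) (forms D)"
proof (rule has_sum_reindex_bij_witness
    [where i = "\<lambda>(a, b, c). (a, b - 2 * a, a - b + c)" and j = "\<lambda>(a, b, c). (a, b + 2 * a, a + b + c)"])
  fix t :: "int \<times> int \<times> int"
  obtain a b c where abc: "t = (a, b, c)" by (cases t)
  have "qval (a, b + 2 * a, a + b + c) x = qval (a, b, c) (x + 1)"
    by (simp add: qval_def algebra_simps power2_eq_square)
  then show "pos_term m x (case t of (a, b, c) \<Rightarrow> (a, b + 2 * a, a + b + c)) = pos_term m (x + 1) t"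
    by (simp add: pos_term_def abc)
qed (auto simp: forms_def algebra_simps power2_eq_square)

lemma has_sum_reflect:
  "(pos_term m (- x) has_sum s) (forms D) \<longleftrightarrow> (pos_term m x has_sum s) (forms D)"
  by (rule has_sum_reindex_bij_witness
      [where i = "\<lambda>(a, b, c). (a, - b, c)" and j = "\<lambda>(a, b, c). (a, - b, c)"])
     (auto simp: forms_def pos_term_def qval_def)

lemma has_sum_shift_int:
  "(pos_term m (x + of_int n) has_sum s) (forms D) \<longleftrightarrow> (pos_term m x has_sum s) (forms D)"
proof (induction n rule: int_induct[where k = 0])
  case (step1 i)
  then show ?case using has_sum_shift[of m "x + of_int i" D s] by (simp add: add_ac)
next
  case (step2 i)
  then show ?case using has_sum_shift[of m "x + of_int i - 1" D s] by (simp add: algebra_simps)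
qed simp

text \<open>The functional equation, in a form that also transports convergence from \<open>x\<close> to \<open>1/x\<close>.\<close>

lemma inversion_has_sum:
  assumes D: "\<not> is_square D" and m: "m \<ge> 1" and x: "x \<noteq> 0"
    and s: "(pos_term m x has_sum s) (forms D)"
  shows "(pos_term m (1 / x) has_sum
           ((s - (\<Sum>t\<in>straddling D. qval t x * \<bar>qval t x\<bar> ^ (m - 1))) / x ^ (2 * m))) (forms D)"
proof -
  define Q where "Q = (\<lambda>t. if snd (snd t) < 0 then (max 0 (qval t x)) ^ m else (0::real))"
  define h where "h = (\<lambda>t. Q t - pos_term m x t)"
  define S where "S = straddling D"
  define N where "N = (\<lambda>(a, b, c). (- a, - b, - c)) ` S"
  define W where "W = (\<Sum>t\<in>S. qval t x * \<bar>qval t x\<bar> ^ (m - 1))"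
  have nz: "a \<noteq> 0 \<and> c \<noteq> 0" if "(a, b, c) \<in> forms D" for a b c
    using D that by (auto simp: forms_def is_nth_power_def)
  have fin: "finite S" "finite N"
    by (auto simp: S_def N_def finite_straddling)
  have inj: "inj_on (\<lambda>(a, b, c). (- a, - b, - c)) S"
    by (auto simp: inj_on_def)
  \<comment> \<open>If \<open>a\<close> and \<open>c\<close> have the same sign, the conditions \<open>a < 0\<close> and \<open>c < 0\<close> agree and \<open>h\<close> vanishes.\<close>
  have "(h has_sum (\<Sum>t\<in>S \<union> N. h t)) (forms D)"
  proof (rule has_sum_finite_neutralI[where B = "S \<union> N"])
    show "S \<union> N \<subseteq> forms D"
      by (auto simp: S_def N_def straddling_def forms_def)
    fix t assume t: "t \<in> forms D - (S \<union> N)"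
    obtain a b c where abc: "t = (a, b, c)" by (cases t)
    have "t \<notin> S" "t \<notin> N" "t \<in> forms D" using t by auto
    then have "\<not> (a < 0 \<and> 0 < c)"
      by (auto simp: S_def straddling_def forms_def abc)
    moreover have "\<not> (c < 0 \<and> 0 < a)"
    proof
      assume "c < 0 \<and> 0 < a"
      then have "(- a, - b, - c) \<in> S"
        using \<open>t \<in> forms D\<close> by (auto simp: S_def straddling_def forms_def abc)
      then have "t \<in> N" unfolding N_def abc by (rule rev_image_eqI) simp
      with \<open>t \<notin> N\<close> show False ..
    qed
    ultimately show "h t = 0"
      using nz[of a b c] t by (auto simp: h_def Q_def pos_term_def abc)
  qed (use fin in auto)
  also have "(\<Sum>t\<in>S \<union> N. h t) = (\<Sum>t\<in>S. h t) + (\<Sum>t\<in>N. h t)"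
  proof (rule sum.union_disjoint[OF fin])
    have "fst t < 0" if "t \<in> S" for t
      using that by (auto simp: S_def straddling_def)
    moreover have "fst t > 0" if "t \<in> N" for t
      using that by (auto simp: N_def S_def straddling_def)
    ultimately show "S \<inter> N = {}" by fastforce
  qed
  also have "(\<Sum>t\<in>N. h t) = (\<Sum>t\<in>S. h (case t of (a, b, c) \<Rightarrow> (- a, - b, - c)))"
    unfolding N_def by (subst sum.reindex[OF inj]) (simp add: o_def)
  also have "(\<Sum>t\<in>S. h t) + \<dots> = - W"
    unfolding W_def sum_negf[symmetric] sum.distrib[symmetric]
  proof (rule sum.cong[OF refl])
    fix t assume t: "t \<in> S"
    obtain a b c where abc: "t = (a, b, c)" by (cases t)
    have ac: "a < 0" "0 < c" using t by (auto simp: abc S_def straddling_def)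
    have q: "qval (- a, - b, - c) x = - qval t x"
      by (simp add: abc qval_def)
    have "h t + h (- a, - b, - c) = (max 0 (- qval t x)) ^ m - (max 0 (qval t x)) ^ m"
      using ac by (simp add: h_def Q_def pos_term_def q) (simp add: abc)
    also have "\<dots> = - (qval t x * \<bar>qval t x\<bar> ^ (m - 1))"
      using m by (cases m) (auto simp: max_def abs_if)
    finally show "h t + h (case t of (a, b, c) \<Rightarrow> (- a, - b, - c))
        = - (qval t x * \<bar>qval t x\<bar> ^ (m - 1))"
      by (simp add: abc)
  qed
  finally have "(h has_sum - W) (forms D)" .
  from has_sum_add[OF this s] have "(Q has_sum (s - W)) (forms D)"
    by (simp add: h_def)
  also have "(Q has_sum (s - W)) (forms D) \<longleftrightarrow>
      ((\<lambda>t. x ^ (2 * m) * pos_term m (1 / x) t) has_sum (s - W)) (forms D)"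
  proof (rule has_sum_reindex_bij_witness
      [where i = "\<lambda>(a, b, c). (c, b, a)" and j = "\<lambda>(a, b, c). (c, b, a)"])
    fix t assume "t \<in> forms D"
    obtain a b c where abc: "t = (a, b, c)" by (cases t)
    have q: "qval t x = x\<^sup>2 * qval (c, b, a) (1 / x)"
      using x by (simp add: abc qval_def field_simps power2_eq_square)
    have "max 0 (qval t x) = x\<^sup>2 * max 0 (qval (c, b, a) (1 / x))"
      unfolding q using x by (auto simp: max_def zero_le_mult_iff mult_le_0_iff)
    then show "x ^ (2 * m) * pos_term m (1 / x) (case t of (a, b, c) \<Rightarrow> (c, b, a)) = Q t"
      by (auto simp: Q_def pos_term_def abc power_mult power_mult_distrib)
  qed (auto simp: forms_def algebra_simps)
  finally show ?thesis
    using x by (simp add: has_sum_cmult_right_iff W_def S_def)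
qed

section \<open>The linear case\<close>

text \<open>The symmetries \<open>b \<mapsto> -b\<close> and \<open>(a, b, c) \<mapsto> (-c, b, -a)\<close> of the index set determine the
  quadratic polynomial on the left up to the factor \<open>\<gamma>\<close>.\<close>

lemma sum_straddling: "(\<Sum>t\<in>straddling D. qval t x) = gam D * (1 - x\<^sup>2)"
proof -
  let ?S = "straddling D"
  have a: "(\<Sum>(a, b, c)\<in>?S. real_of_int a) = - gam D"
    unfolding gam_def sum_negf[symmetric]
    by (rule sum.reindex_bij_witness
        [where i = "\<lambda>(a, b, c). (- c, b, - a)" and j = "\<lambda>(a, b, c). (- c, b, - a)"])
       (auto simp: straddling_def algebra_simps)
  have "(\<Sum>(a, b, c)\<in>?S. real_of_int b) = (\<Sum>(a, b, c)\<in>?S. - real_of_int b)"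
    by (rule sum.reindex_bij_witness
        [where i = "\<lambda>(a, b, c). (a, - b, c)" and j = "\<lambda>(a, b, c). (a, - b, c)"])
       (auto simp: straddling_def)
  then have b: "(\<Sum>(a, b, c)\<in>?S. real_of_int b) = 0"
    by (simp add: case_prod_unfold sum_negf)
  have "(\<Sum>t\<in>?S. qval t x) =
      (\<Sum>(a, b, c)\<in>?S. real_of_int a) * x\<^sup>2 + (\<Sum>(a, b, c)\<in>?S. real_of_int b) * x + gam D"
    by (simp add: gam_def qval_def case_prod_unfold sum.distrib sum_distrib_right)
  then show ?thesis
    by (simp add: a b algebra_simps)
qed

lemma gam_nonneg: "gam D \<ge> 0"
  unfolding gam_def by (rule sum_nonneg) (auto simp: straddling_def)

lemma inversion_has_sum_linear:
  assumes "\<not> is_square D" and "x \<noteq> 0" and "(pos_term 1 x has_sum s) (forms D)"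
  shows "(pos_term 1 (1 / x) has_sum ((s - gam D * (1 - x\<^sup>2)) / x\<^sup>2)) (forms D)"
  using inversion_has_sum[OF assms(1) _ assms(2,3)] by (simp add: sum_straddling)

lemma has_sum_at_0: "(pos_term 1 0 has_sum gam D) (forms D)"
proof (rule has_sum_finite_neutralI[where B = "straddling D"])
  show "gam D = (\<Sum>t\<in>straddling D. pos_term 1 0 t)"
    unfolding gam_def
    by (rule sum.cong) (auto simp: pos_term_def qval_def straddling_def)
qed (auto simp: finite_straddling, auto simp: straddling_def forms_def pos_term_def qval_def)

text \<open>One step of the Euclidean algorithm is a translation followed by an inversion, and both
  preserve the value \<open>\<gamma>\<close>.\<close>

lemma has_sum_at_fraction:
  assumes D: "\<not> is_square D"
  shows "q > 0 \<Longrightarrow> (pos_term 1 (of_int p / of_nat q) has_sum gam D) (forms D)"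
proof (induction q arbitrary: p rule: less_induct)
  case (less q)
  define r where "r = nat (p mod int q)"
  have r: "int r = p mod int q" "r < q"
    using less.prems by (simp_all add: r_def nat_less_iff)
  have "real_of_int p = real_of_int (p div int q * int q + p mod int q)"
    by simp
  then have p: "real_of_int p / real q = real r / real q + of_int (p div int q)"
    using less.prems unfolding r(1)[symmetric] by (simp add: field_simps)
  have "(pos_term 1 (real r / real q) has_sum gam D) (forms D)"
  proof (cases "r = 0")
    case True
    then show ?thesis using has_sum_at_0 by simp
  next
    case False
    have "(pos_term 1 (real q / real r) has_sum gam D) (forms D)"
      using less.IH[OF r(2), of "int q"] False by simp
    from inversion_has_sum_linear[OF D _ this] show ?thesis
      using less.prems False by (simp add: algebra_simps)
  qed
  then show ?case
    unfolding p has_sum_shift_int .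
qed

lemma has_sum_at_Rats:
  assumes "\<not> is_square D" and "x \<in> \<rat>"
  shows "(pos_term 1 x has_sum gam D) (forms D)"
proof -
  obtain p q where "q > 0" "x = of_int p / of_int q"
    using assms(2) by (rule Rats_cases')
  then show ?thesis
    using has_sum_at_fraction[OF assms(1), of "nat q" p] by simp
qed

lemma isCont_pos_term: "isCont (\<lambda>x. pos_term m x t) x"
  unfolding pos_term_def qval_def case_prod_unfold
  by (cases "fst t < 0") (auto intro!: continuous_intros)

text \<open>An inequality that is known at rational points only extends by continuity, because only
  finitely many summands are involved.\<close>

lemma partial_sum_le_gam:
  assumes D: "\<not> is_square D" and F: "finite F" "F \<subseteq> forms D"
  shows "(\<Sum>t\<in>F. pos_term 1 x t) \<le> gam D"
proof (rule ccontr)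
  assume "\<not> ?thesis"
  then have gt: "(\<Sum>t\<in>F. pos_term 1 x t) > gam D" by simp
  have "isCont (\<lambda>y. \<Sum>t\<in>F. pos_term 1 y t) x"
    by (intro continuous_intros isCont_pos_term)
  then have "\<forall>\<^sub>F y in at x. (\<Sum>t\<in>F. pos_term 1 y t) > gam D"
    unfolding isCont_def using gt by (rule order_tendstoD(1))
  then obtain e where
    e: "e > 0" "\<And>y. y \<noteq> x \<Longrightarrow> dist y x < e \<Longrightarrow> (\<Sum>t\<in>F. pos_term 1 y t) > gam D"
    by (auto simp: eventually_at)
  obtain y where y: "y \<in> \<rat>" "x < y" "y < x + e"
    using Rats_dense_in_real[of x "x + e"] e(1) by auto
  have "(\<Sum>t\<in>F. pos_term 1 y t) \<le> gam D"
    by (rule finite_sum_le_has_sum[OF has_sum_at_Rats[OF D y(1)] F]) (simp add: pos_term_nonneg)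
  with e(2)[of y] y show False by (simp add: dist_real_def)
qed

lemma summable_pos_term_linear:
  assumes "\<not> is_square D"
  shows "pos_term 1 x summable_on forms D"
proof (rule nonneg_bdd_above_summable_on)
  show "bdd_above (sum (pos_term 1 x) ` {F. F \<subseteq> forms D \<and> finite F})"
    using partial_sum_le_gam[OF assms] by (auto intro!: bdd_aboveI[of _ "gam D"])
qed (simp add: pos_term_nonneg)

lemma has_sum_linear:
  assumes D: "\<not> is_square D"
  shows "(pos_term 1 x has_sum gam D) (forms D)"
proof -
  define S where "S x = infsum (pos_term 1 x) (forms D)" for x
  have S: "(pos_term 1 x has_sum S x) (forms D)" for x
    using summable_pos_term_linear[OF D] by (simp add: S_def)
  define g where "g x = gam D - S x" for x
  have g_shift: "g (x + of_int n) = g x" for x n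
    using has_sum_unique[OF _ S[of x]] S[of "x + of_int n"] by (simp add: has_sum_shift_int g_def)
  have g_inv: "g x = x\<^sup>2 * g (1 / x)" if "x \<noteq> 0" for x
    using has_sum_unique[OF inversion_has_sum_linear[OF D that S] S] that
    by (simp add: g_def field_simps)
  have g_nonneg: "g x \<ge> 0" for x
    unfolding g_def S_def
    using infsum_le_finite_sums[OF summable_pos_term_linear[OF D] partial_sum_le_gam[OF D]] by simp
  have g_le: "g x \<le> gam D" for x
    unfolding g_def S_def by (simp add: infsum_nonneg pos_term_nonneg)
  have g_0: "g 0 = 0"
    using has_sum_unique[OF has_sum_at_0 S] by (simp add: g_def)
  \<comment> \<open>The distance to the nearest integer is at most \<open>1/2\<close>, so each inversion gains a factor \<open>1/4\<close>.\<close>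
  have bound: "g x \<le> gam D / 4 ^ n" for x n
  proof (induction n arbitrary: x)
    case 0
    then show ?case using g_le by simp
  next
    case (Suc n)
    define y where "y = x - of_int (round x)"
    have gy: "g x = g y"
      using g_shift[of y "round x"] by (simp add: y_def)
    have "\<bar>y\<bar> \<le> 1 / 2"
      using of_int_round_abs_le[of x] by (simp add: y_def abs_minus_commute)
    then have y2: "y\<^sup>2 \<le> 1 / 4"
      using power_mono[of "\<bar>y\<bar>" "1 / 2" 2] by (simp add: power2_eq_square)
    show ?case
    proof (cases "y = 0")
      case True
      then show ?thesis using gy g_0 gam_nonneg by simp
    next
      case False
      have "g y = y\<^sup>2 * g (1 / y)" using g_inv False by blast
      also have "\<dots> \<le> 1 / 4 * (gam D / 4 ^ n)"
        by (intro mult_mono y2 Suc.IH g_nonneg) auto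
      finally show ?thesis using gy by simp
    qed
  qed
  have "(\<lambda>n. gam D * (1 / 4) ^ n) \<longlonglongrightarrow> gam D * 0"
    by (intro tendsto_mult tendsto_const LIMSEQ_power_zero) simp
  then have "g x \<le> 0"
    using bound[of x] by (intro LIMSEQ_le_const[of _ 0]) (auto simp: power_one_over)
  then have "S x = gam D"
    using g_nonneg[of x] by (simp add: g_def)
  then show ?thesis using S[of x] by simp
qed

section \<open>General exponents\<close>

text \<open>Completing the square, \<open>4 \<bar>a\<bar> R(x) = D - (2 a x + b)\<^sup>2 \<le> D\<close>.\<close>

lemma pos_term_le:
  assumes "D > 0" and "m \<ge> 1" and "t \<in> forms D"
  shows "pos_term m x t \<le> of_int D ^ (m - 1) * pos_term 1 x t"
proof -
  obtain a b c where abc: "t = (a, b, c)" by (cases t)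
  show ?thesis
  proof (cases "a < 0 \<and> 0 < qval t x")
    case True
    then have a: "real_of_int a \<le> -1" and q: "0 < qval t x" by auto
    have "real_of_int D = of_int (b\<^sup>2 - 4 * a * c)"
      using assms(3) by (simp add: forms_def abc)
    then have "4 * - real_of_int a * qval t x = real_of_int D - (2 * of_int a * x + of_int b)\<^sup>2"
      by (simp add: abc qval_def algebra_simps power2_eq_square)
    also have "\<dots> \<le> of_int D" by simp
    finally have "4 * - real_of_int a * qval t x \<le> of_int D" .
    moreover have "1 * qval t x \<le> (4 * - real_of_int a) * qval t x"
      using a q by (intro mult_right_mono) auto
    ultimately have "qval t x \<le> of_int D" by simp
    then have "qval t x ^ (m - 1) * qval t x \<le> of_int D ^ (m - 1) * qval t x"
      using q by (intro mult_right_mono power_mono) auto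
    moreover have "qval t x ^ m = qval t x ^ (m - 1) * qval t x"
      using assms(2) by (cases m) auto
    ultimately show ?thesis
      using True by (simp add: pos_term_def)
  next
    case False
    then show ?thesis
      using assms(2) by (cases m) (auto simp: pos_term_def abc max_def)
  qed
qed

lemma summable_pos_term:
  assumes "D > 0" and "\<not> is_square D" and "m \<ge> 1"
  shows "pos_term m x summable_on forms D"
proof (rule summable_on_comparison_test)
  show "(\<lambda>t. of_int D ^ (m - 1) * pos_term 1 x t) summable_on forms D"
    by (intro summable_on_cmult_right summable_pos_term_linear assms)
qed (use pos_term_le[OF assms(1,3)] in \<open>auto simp: pos_term_nonneg\<close>)

text \<open>A finite partial sum that exceeds \<open>z\<close> at \<open>x\<close> does so nearby, and by nonnegativity it bounds
  the full sum from below.\<close>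

lemma lower_semicontinuous_infsum:
  fixes f :: "'a::t2_space \<Rightarrow> 'b \<Rightarrow> real"
  assumes cont: "\<And>t. t \<in> A \<Longrightarrow> isCont (\<lambda>y. f y t) x"
    and nonneg: "\<And>y t. t \<in> A \<Longrightarrow> f y t \<ge> 0"
    and sum: "\<And>y. f y summable_on A"
    and less: "z < infsum (f x) A"
  shows "\<forall>\<^sub>F y in at x. z < infsum (f y) A"
proof -
  obtain F where F: "finite F" "F \<subseteq> A" "z < sum (f x) F"
    using infsum_le_finite_sums[OF sum[of x], of z] less by (meson linorder_not_less)
  have "((\<lambda>y. sum (f y) F) \<longlongrightarrow> sum (f x) F) (at x)"
    using cont F(2) by (intro tendsto_sum) (auto simp: isCont_def)
  then have "\<forall>\<^sub>F y in at x. z < sum (f y) F"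
    using F(3) order_tendstoD(1) by blast
  then show ?thesis
  proof eventually_elim
    case (elim y)
    also have "sum (f y) F \<le> infsum (f y) A"
      by (intro finite_sum_le_infsum sum F) (use nonneg in auto)
    finally show ?case .
  qed
qed

lemma continuous_infsum_pos_term:
  assumes "D > 0" and "\<not> is_square D" and "m \<ge> 1"
  shows "isCont (\<lambda>x. infsum (pos_term m x) (forms D)) x"
proof -
  define C where "C = real_of_int D ^ (m - 1)"
  define f where "f y t = C * pos_term 1 y t - pos_term m y t" for y t
  have f: "(f y has_sum (C * gam D - infsum (pos_term m y) (forms D))) (forms D)" for y
    unfolding f_def diff_conv_add_uminus
    by (intro has_sum_add has_sum_cmult_right has_sum_linear assms)
       (simp add: has_sum_uminus has_sum_infsum[OF summable_pos_term[OF assms]])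
  have inf_f: "infsum (f y) (forms D) = C * gam D - infsum (pos_term m y) (forms D)" for y
    by (rule infsumI[OF f])
  show ?thesis
    unfolding isCont_def
  proof (rule order_tendstoI)
    fix z assume "z < infsum (pos_term m x) (forms D)"
    then show "\<forall>\<^sub>F y in at x. z < infsum (pos_term m y) (forms D)"
      by (intro lower_semicontinuous_infsum isCont_pos_term pos_term_nonneg
            summable_pos_term assms)
  next
    fix z assume "infsum (pos_term m x) (forms D) < z"
    then have "C * gam D - z < infsum (f x) (forms D)" by (simp add: inf_f)
    then have "\<forall>\<^sub>F y in at x. C * gam D - z < infsum (f y) (forms D)"
    proof (rule lower_semicontinuous_infsum[rotated 3])
      show "isCont (\<lambda>y. f y t) x" for t
        unfolding f_def by (intro continuous_intros isCont_pos_term)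
      show "f y t \<ge> 0" if "t \<in> forms D" for y t
        using pos_term_le[OF assms(1,3) that] by (simp add: f_def C_def)
      show "f y summable_on forms D" for y
        using f summable_on_def by blast
    qed
    then show "\<forall>\<^sub>F y in at x. infsum (pos_term m y) (forms D) < z"
      by eventually_elim (simp add: inf_f)
  qed
qed

theorem mainTheorem3:
  fixes D :: int and m :: nat
  assumes "D > 0" and "\<not> is_square D" and "m \<ge> 1"
  shows "(\<forall>x::real. (\<lambda>R. eval_real R x ^ m) summable_on neg_quads D x) \<and>
         bounded (range (A_sum (m + 1) D)) \<and>
         (\<forall>x. A_sum (m + 1) D (- x) = A_sum (m + 1) D x) \<and>
         (\<forall>x. A_sum (m + 1) D (x + 1) = A_sum (m + 1) D x) \<and>
         continuous_on UNIV (A_sum (m + 1) D) \<and>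
         finite (neg_quads D 0) \<and>
         (\<forall>x. x \<noteq> 0 \<longrightarrow>
            x ^ (2 * m) * A_sum (m + 1) D (1 / x) - A_sum (m + 1) D x =
              - (\<Sum>R\<in>neg_quads D 0. eval_real R x * \<bar>eval_real R x\<bar> ^ (m - 1)))"
proof -
  define A where "A x = infsum (pos_term m x) (forms D)" for x
  have A: "(pos_term m x has_sum A x) (forms D)" for x
    unfolding A_def by (rule has_sum_infsum[OF summable_pos_term[OF assms]])
  have hs: "((\<lambda>R. eval_real R x ^ m) has_sum A x) (neg_quads D x)" for x
    using A has_sum_neg_quads_iff[OF assms(3)] by blast
  have A_sum: "A_sum (m + 1) D = A"
    using hs by (auto simp: A_sum_def infsumI)
  have summable: "(\<lambda>R. eval_real R x ^ m) summable_on neg_quads D x" for x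
    using hs summable_on_def by blast
  have "norm (A x) \<le> of_int D ^ (m - 1) * gam D" for x
  proof -
    have "A x \<le> of_int D ^ (m - 1) * gam D"
      by (rule has_sum_mono[OF A has_sum_cmult_right[OF has_sum_linear[OF assms(2)]]])
         (rule pos_term_le[OF assms(1,3)])
    moreover have "A x \<ge> 0"
      by (simp add: A_def infsum_nonneg pos_term_nonneg)
    ultimately show ?thesis by simp
  qed
  then have bounded: "bounded (range A)"
    by (auto simp: bounded_iff)
  have even: "A (- x) = A x" for x
    using has_sum_unique[OF _ A[of x]] A[of "- x"] by (simp add: has_sum_reflect)
  have periodic: "A (x + 1) = A x" for x
    using has_sum_unique[OF _ A[of x]] A[of "x + 1"] by (simp add: has_sum_shift)
  have cont: "continuous_on UNIV A"
    unfolding A_def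
    by (intro continuous_at_imp_continuous_on ballI continuous_infsum_pos_term assms)
  have quads: "neg_quads D 0 = to_poly ` straddling D"
    unfolding neg_quads_eq straddling_eq ..
  have "x ^ (2 * m) * A (1 / x) - A x =
      - (\<Sum>R\<in>neg_quads D 0. eval_real R x * \<bar>eval_real R x\<bar> ^ (m - 1))" if "x \<noteq> 0" for x
  proof -
    have "(\<Sum>R\<in>neg_quads D 0. eval_real R x * \<bar>eval_real R x\<bar> ^ (m - 1)) =
        (\<Sum>t\<in>straddling D. qval t x * \<bar>qval t x\<bar> ^ (m - 1))"
      unfolding quads
      by (subst sum.reindex) (auto intro: inj_on_subset[OF inj_to_poly] simp: eval_to_poly)
    then show ?thesis
      using has_sum_unique[OF inversion_has_sum[OF assms(2,3) that A] A] that
      by (simp add: field_simps)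
  qed
  then show ?thesis
    unfolding A_sum
    using summable bounded even periodic cont quads finite_straddling[of D] by simp
qed

end
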